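(* Algorithm NG is a $\bigl(4k\ln(\tfrac1\epsilon)+8k\bigr)$-approximation for SRMA: for every instance $I$ of SRMA with $k$ agents and minimum non-zero marginal value $\epsilon$, the permutation $\pi$ output by algorithm NG satisfies $$\max_{i\in[k]}\sum_{j=1}^m w^{(i)}_j\,\mathrm{cov}(f^{(i)}_j,\pi)\ \le\ \Bigl(4k\ln\tfrac1\epsilon+8k\Bigr)\cdot\mathrm{OPT}(I).$$
   Context: **SRMA (min-max submodular ranking for multiple agents).** An instance consists of a ground set $U=[n]$, $k$ agents $a_1,\dots,a_k$, and for each agent $a_i$, monotone submodular functions $f^{(i)}_1,\dots,f^{(i)}_m:2^{[n]}\to[0,1]$ with $f^{(i)}_j(U)=1$ and weights $w^{(i)}_j>0$. For a permutation $\pi$ of $U$, the cover time $\mathrm{cov}(f,\pi)$ is the smallest index $t\in\{1,\dots,n\}$ such that $f$ has value $1$ on the set of the first $t$ elements of $\pi$. The objective value of $\pi$ is $\max_{i\in[k]}\sum_{j=1}^m w^{(i)}_j\mathrm{cov}(f^{(i)}_j,\pi)$; $\mathrm{OPT}(I)$ is its minimum over all permutations. $\epsilon>0$ is the minimum non-zero marginal value: for all $S\subseteq S'$ and all $i,j$, $f^{(i)}_j(S')>f^{(i)}_j(S)$ implies $f^{(i)}_j(S')-f^{(i)}_j(S)\ge\epsilon$. **Algorithm NG (normalized greedy).** View all $m\cdot k$ functions as one single collection. Select elements one at a time: if $S$ is the set of elements chosen so far and $\mathcal F$ is the set of functions $f$ (among all agents) with $f(S)<1$, choose next an element $e\in U\setminus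 S$ maximizing $\sum_{f\in\mathcal F} w_f\cdot\frac{f(S\cup\{e\})-f(S)}{1-f(S)}$, where $w_f$ is the weight of $f$. The order of selection is the output permutation (elements remaining after all functions are covered are appended arbitrarily). *)

theory Defs
  imports Complex_Main "HOL-Combinatorics.Multiset_Permutations"
begin

text \<open>
  Agents are \<open>1, \<dots>, k\<close>, the functions of each agent are \<open>1, \<dots>, m\<close>, and
  \<open>fn I i j\<close>, \<open>wt I i j\<close> are the \<open>j\<close>-th function and weight of agent \<open>i\<close>.
  Only the values of \<open>fn I i j\<close> on subsets of the ground set matter.
\<close>

record srma =
  ground_size :: nat
  agents :: nat
  funs :: nat
  fn :: "nat \<Rightarrow> nat \<Rightarrow> nat set \<Rightarrow> real"
  wt :: "nat \<Rightarrow> nat \<Rightarrow> real"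

definition ground :: "srma \<Rightarrow> nat set" where
  "ground I = {1..ground_size I}"

definition submodular_on :: "'a set \<Rightarrow> ('a set \<Rightarrow> real) \<Rightarrow> bool" where
  "submodular_on U g \<longleftrightarrow>
     (\<forall>A\<subseteq>U. \<forall>B\<subseteq>U. g (A \<union> B) + g (A \<inter> B) \<le> g A + g B)"

definition srma_instance :: "srma \<Rightarrow> bool" where
  "srma_instance I \<longleftrightarrow>
     ground_size I \<ge> 1 \<and> agents I \<ge> 1 \<and>
     (\<forall>i\<in>{1..agents I}. \<forall>j\<in>{1..funs I}.
        mono_on (Pow (ground I)) (fn I i j) \<and>
        submodular_on (ground I) (fn I i j) \<and>
        (\<forall>S\<subseteq>ground I. fn I i j S \<in> {0..1}) \<and>
        fn I i j (ground I) = 1 \<and>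
        wt I i j > 0)"

text \<open>
  Any non-zero marginal is at most 1, so the minimum non-zero marginal value satisfies this
  predicate (lemma \<open>least_marginal_bound\<close>).  The clause \<open>\<epsilon> \<le> 1\<close> only has an effect
  when all functions are constant, i.e. when there is no non-zero marginal at all.
\<close>

definition marginal_bound :: "srma \<Rightarrow> real \<Rightarrow> bool" where
  "marginal_bound I \<epsilon> \<longleftrightarrow>
     0 < \<epsilon> \<and> \<epsilon> \<le> 1 \<and>
     (\<forall>i\<in>{1..agents I}. \<forall>j\<in>{1..funs I}. \<forall>S S'.
        S \<subseteq> S' \<longrightarrow> S' \<subseteq> ground I \<longrightarrow> fn I i j S' > fn I i j S \<longrightarrow>
        fn I i j S' - fn I i j S \<ge> \<epsilon>)"

definition nonzero_marginals :: "srma \<Rightarrow> real set" where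
  "nonzero_marginals I =
     {fn I i j S' - fn I i j S | i j S S'.
        i \<in> {1..agents I} \<and> j \<in> {1..funs I} \<and> S \<subseteq> S' \<and> S' \<subseteq> ground I \<and>
        fn I i j S' > fn I i j S}"

lemma least_marginal_bound:
  assumes I: "srma_instance I"
    and e: "\<epsilon> \<in> nonzero_marginals I"
    and least: "\<And>x. x \<in> nonzero_marginals I \<Longrightarrow> \<epsilon> \<le> x"
  shows "marginal_bound I \<epsilon>"
proof -
  obtain i j S S' where ij: "i \<in> {1..agents I}" "j \<in> {1..funs I}"
    and S: "S \<subseteq> S'" "S' \<subseteq> ground I" "fn I i j S' > fn I i j S"
    and eq: "\<epsilon> = fn I i j S' - fn I i j S"
    using e unfolding nonzero_marginals_def by blast
  have "fn I i j S' \<in> {0..1}" "fn I i j S \<in> {0..1}"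
    using I ij S unfolding srma_instance_def by (meson subset_trans)+
  then have "0 < \<epsilon>" "\<epsilon> \<le> 1"
    using S eq by auto
  then show ?thesis
    using least unfolding marginal_bound_def nonzero_marginals_def by blast
qed

text \<open>A permutation of the ground set is a list in \<open>permutations_of_set (ground I)\<close>.\<close>

definition cov :: "('a set \<Rightarrow> real) \<Rightarrow> 'a list \<Rightarrow> nat" where
  "cov g \<pi> = (LEAST t. t \<in> {1..length \<pi>} \<and> g (set (take t \<pi>)) = 1)"

definition objective :: "srma \<Rightarrow> nat list \<Rightarrow> real" where
  "objective I \<pi> =
     Max ((\<lambda>i. \<Sum>j=1..funs I. wt I i j * real (cov (fn I i j) \<pi>)) ` {1..agents I})"

definition OPT :: "srma \<Rightarrow> real" where
  "OPT I = Min (objective I ` permutations_of_set (ground I))"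

text \<open>Functions are indexed by pairs, so equal functions are counted with multiplicity.\<close>

definition uncovered :: "srma \<Rightarrow> nat set \<Rightarrow> (nat \<times> nat) set" where
  "uncovered I S = {(i, j) \<in> {1..agents I} \<times> {1..funs I}. fn I i j S < 1}"

definition score :: "srma \<Rightarrow> nat set \<Rightarrow> nat \<Rightarrow> real" where
  "score I S e =
     (\<Sum>(i, j)\<in>uncovered I S. wt I i j * ((fn I i j (insert e S) - fn I i j S) / (1 - fn I i j S)))"

text \<open>
  \<open>NG_run I xs\<close>: the algorithm may have selected \<open>xs\<close>, in this order.  Ties, and the order
  of the elements left once everything is covered, are resolved arbitrarily.
\<close>

inductive NG_run :: "srma \<Rightarrow> nat list \<Rightarrow> bool" for I where
  start: "NG_run I []"
| greedy: "\<lbrakk>NG_run I xs; uncovered I (set xs) \<noteq> {};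
            is_arg_max (score I (set xs)) (\<lambda>e. e \<in> ground I - set xs) e\<rbrakk>
           \<Longrightarrow> NG_run I (xs @ [e])"
| rest: "\<lbrakk>NG_run I xs; uncovered I (set xs) = {}; e \<in> ground I - set xs\<rbrakk>
         \<Longrightarrow> NG_run I (xs @ [e])"

definition NG_output :: "srma \<Rightarrow> nat list \<Rightarrow> bool" where
  "NG_output I \<pi> \<longleftrightarrow> NG_run I \<pi> \<and> set \<pi> = ground I"

lemma NG_output_permutation:
  assumes "NG_output I \<pi>"
  shows "\<pi> \<in> permutations_of_set (ground I)"
proof -
  have "distinct \<pi>" if "NG_run I \<pi>"
    using that by induction (auto simp: is_arg_max_def)
  then show ?thesis
    using assms by (auto simp: NG_output_def permutations_of_set_def)
qed

end

(* Since max \<le> sum \<le> k \<cdot> max over the agents, it suffices to compare the sum over all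
   agents of the weighted cover times.  Up to the functions that are already covered by the empty set,
   such a sum is the total uncovered weight \<Sum>R(t) over all times t.  Let R(s) and P(s) be
   the uncovered weight and the score of greedy's choice at time s, and let R'(\<tau>) be the uncovered
   weight of any other permutation.  By submodularity the first \<tau> elements of that permutation
   cover at most \<tau> P(s) of R(s), so R(s) \<le> 2 R'(\<tau>) whenever 2 \<tau> P(s) \<le> R(s).
   On the other hand the scores from time s on sum up to at most (1 + ln (1/\<epsilon>)) R(s),
   because each function contributes a sum of the form \<Sum>(a(s) - a(s+1)) / a(s).  Double counting the
   pairs (s, \<tau>) with 2 \<tau> P(s) \<le> R(s), weighted by P(s), gives the factor
   4 (1 + ln (1/\<epsilon>)). *)
theory Submission
  imports Defs
begin

section \<open>Preliminaries on one sequence and one function\<close>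

text \<open>A telescoping potential bounds the relative decreases. A step between positive values
  costs at most the drop in the logarithm, by ln x \<le> x - 1; a drop to 0 costs exactly 1, which
  the summand 1 in the potential pays for, since \<open>a s\<close> is still at least \<epsilon>
  just before.\<close>

lemma sum_relative_decrease_le:
  fixes a :: "nat \<Rightarrow> real"
  assumes eps: "0 < \<epsilon>"
    and dec: "\<And>s. a (Suc s) \<le> a s"
    and range: "\<And>s. 0 \<le> a s" "\<And>s. a s \<le> 1"
    and gap: "\<And>s. 0 < a s \<Longrightarrow> \<epsilon> \<le> a s"
  shows "(\<Sum>s=t..<n. (a s - a (Suc s)) / a s) \<le> (if a t = 0 then 0 else 1 + ln (1 / \<epsilon>))"
proof -
  define \<phi> where "\<phi> s = (if a s = 0 then 0 else 1 + ln (a s / \<epsilon>))" for s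
  have pos: "0 \<le> \<phi> s" for s
    using range(1)[of s] gap[of s] eps by (auto simp: \<phi>_def intro!: add_nonneg_nonneg)
  have step: "(a s - a (Suc s)) / a s \<le> \<phi> s - \<phi> (Suc s)" for s
  proof (cases "a s = 0")
    case True
    then show ?thesis
      using dec[of s] range(1)[of "Suc s"] by (simp add: \<phi>_def)
  next
    case False
    then have as: "0 < a s" using range(1)[of s] by simp
    show ?thesis
    proof (cases "a (Suc s) = 0")
      case True
      then show ?thesis
        using as gap[OF as] eps by (simp add: \<phi>_def)
    next
      case False
      then have as': "0 < a (Suc s)" using range(1)[of "Suc s"] by simp
      have "ln (a (Suc s) / a s) \<le> a (Suc s) / a s - 1"
        using as as' by (intro ln_le_minus_one) simp
      then show ?thesis
        using as as' eps by (simp add: \<phi>_def ln_div diff_divide_distrib)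
    qed
  qed
  have "(\<Sum>s=t..<n. (a s - a (Suc s)) / a s) \<le> \<phi> t"
  proof (cases "t \<le> n")
    case True
    have "(\<Sum>s=t..<n. (a s - a (Suc s)) / a s) \<le> (\<Sum>s=t..<n. \<phi> s - \<phi> (Suc s))"
      by (intro sum_mono step)
    also have "\<dots> = \<phi> t - \<phi> n"
      using sum_Suc_diff'[OF True, of "\<lambda>s. - \<phi> s"] by simp
    finally show ?thesis using pos[of n] by simp
  qed (simp add: pos)
  also have "\<phi> t \<le> (if a t = 0 then 0 else 1 + ln (1 / \<epsilon>))"
    using range[of t] eps by (auto simp: \<phi>_def divide_right_mono)
  finally show ?thesis .
qed

text \<open>The cover time counts the proper prefixes that do not yet cover, starting from the empty
  one. Cover times start at 1, so a function that is covered by the empty set has count 0 and needs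
  the correction 1.\<close>

lemma cov_eq_card:
  assumes ne: "xs \<noteq> []"
    and full: "g (set xs) = (1 :: real)"
    and mono: "mono_on (Pow (set xs)) g"
  shows "cov g xs = card {t. t < length xs \<and> g (set (take t xs)) < 1} + (if g {} = 1 then 1 else 0)"
proof -
  let ?Q = "\<lambda>t. t \<in> {1..length xs} \<and> g (set (take t xs)) = 1"
  have "?Q (length xs)" using ne full by (simp add: Suc_le_eq)
  then have c: "?Q (cov g xs)" unfolding cov_def by (rule LeastI)
  have least: "cov g xs \<le> t" if "?Q t" for t
    using that unfolding cov_def by (rule Least_le)
  have mono': "g (set (take s xs)) \<le> g (set (take t xs))" if "s \<le> t" for s t
    using that by (intro mono_onD[OF mono]) (auto dest: in_set_takeD set_take_subset_set_take[THEN subsetD])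
  have le1: "g (set (take t xs)) \<le> 1" for t
    using mono_onD[OF mono, of "set (take t xs)" "set xs"] full by (auto dest: in_set_takeD)
  show ?thesis
  proof (cases "g {} = 1")
    case True
    then have "g (set (take t xs)) = 1" for t
      using mono'[of 0 t] le1[of t] by simp
    moreover from this have "cov g xs = 1"
      using c least[of 1] ne by (simp add: Suc_le_eq)
    ultimately show ?thesis using True by simp
  next
    case False
    have "{t. t < length xs \<and> g (set (take t xs)) < 1} = {..<cov g xs}"
    proof (intro equalityI subsetI)
      fix t assume t: "t \<in> {t. t < length xs \<and> g (set (take t xs)) < 1}"
      then have "\<not> cov g xs \<le> t" using mono'[of "cov g xs" t] c by auto
      then show "t \<in> {..<cov g xs}" by simp
    next
      fix t assume t: "t \<in> {..<cov g xs}"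
      then have "t < length xs" using c by auto
      \<comment> \<open>Index 0 is no candidate for the minimum, so there the claim comes from
        \<open>g {} \<noteq> 1\<close> instead of minimality.\<close>
      moreover have "g (set (take t xs)) \<noteq> 1"
        using False least[of t] t \<open>t < length xs\<close> by (cases "t = 0") auto
      ultimately show "t \<in> {t. t < length xs \<and> g (set (take t xs)) < 1}"
        using le1[of t] by simp
    qed
    then show ?thesis using False by simp
  qed
qed

section \<open>Greedy ranking of a single weighted family\<close>

text \<open>Agents are merged into one index set \<open>F\<close>. The parameter \<epsilon> enters
  as a lower bound on the positive deficits \<open>1 - g f S\<close>.\<close>

locale submodular_ranking =
  fixes U :: "'a set" and F :: "'i set" and g :: "'i \<Rightarrow> 'a set \<Rightarrow> real"
    and w :: "'i \<Rightarrow> real" and \<epsilon> :: real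
  assumes finite_U: "finite U" and finite_F: "finite F"
    and mono: "\<And>f. f \<in> F \<Longrightarrow> mono_on (Pow U) (g f)"
    and submodular: "\<And>f. f \<in> F \<Longrightarrow> submodular_on U (g f)"
    and full: "\<And>f. f \<in> F \<Longrightarrow> g f U = 1"
    and nonneg: "\<And>f S. f \<in> F \<Longrightarrow> S \<subseteq> U \<Longrightarrow> 0 \<le> g f S"
    and weight_pos: "\<And>f. f \<in> F \<Longrightarrow> 0 < w f"
    and eps: "0 < \<epsilon>" "\<epsilon> \<le> 1"
    and gap: "\<And>f S. f \<in> F \<Longrightarrow> S \<subseteq> U \<Longrightarrow> g f S < 1 \<Longrightarrow> \<epsilon> \<le> 1 - g f S"
begin

definition uncov :: "'a set \<Rightarrow> 'i set" where
  "uncov S = {f \<in> F. g f S < 1}"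

definition remaining :: "'a set \<Rightarrow> real" where
  "remaining S = sum w (uncov S)"

definition gain :: "'a set \<Rightarrow> 'a \<Rightarrow> real" where
  "gain S e = (\<Sum>f\<in>uncov S. w f * ((g f (insert e S) - g f S) / (1 - g f S)))"

definition greedy :: "'a list \<Rightarrow> bool" where
  "greedy xs \<longleftrightarrow> (\<forall>t<length xs. uncov (set (take t xs)) \<noteq> {} \<longrightarrow>
     (\<forall>e\<in>U - set (take t xs). gain (set (take t xs)) e \<le> gain (set (take t xs)) (xs ! t)))"

lemma g_mono: "f \<in> F \<Longrightarrow> A \<subseteq> B \<Longrightarrow> B \<subseteq> U \<Longrightarrow> g f A \<le> g f B"
  by (rule mono_onD[OF mono]) auto

lemma g_le_1: "f \<in> F \<Longrightarrow> S \<subseteq> U \<Longrightarrow> g f S \<le> 1"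
  using g_mono[of f S U] full by auto

lemma remaining_eq: "remaining S = (\<Sum>f\<in>F. w f * of_bool (g f S < 1))"
  unfolding remaining_def uncov_def using finite_F
  by (intro sum.mono_neutral_cong_left) auto

(* A covered function contributes 0 because of division by zero. *)
lemma gain_eq:
  assumes "S \<subseteq> U"
  shows "gain S e = (\<Sum>f\<in>F. w f * ((g f (insert e S) - g f S) / (1 - g f S)))"
  unfolding gain_def uncov_def using finite_F g_le_1[OF _ assms]
  by (intro sum.mono_neutral_cong_left) (force simp: not_less intro: antisym)+

lemma remaining_nonneg: "0 \<le> remaining S"
  unfolding remaining_def uncov_def by (intro sum_nonneg) (auto intro: less_imp_le weight_pos)

lemma remaining_U: "remaining U = 0"
  unfolding remaining_def uncov_def by (intro sum.neutral) (auto simp: full)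

lemma gain_nonneg: "S \<subseteq> U \<Longrightarrow> e \<in> U \<Longrightarrow> 0 \<le> gain S e"
  unfolding gain_def uncov_def
  by (intro sum_nonneg) (auto intro!: mult_nonneg_nonneg divide_nonneg_nonneg g_mono less_imp_le[OF weight_pos])

text \<open>Each new element \<open>e\<close> adds to \<open>S \<union> A\<close> at most what it
  adds to \<open>S\<close>: submodularity is applied to \<open>S \<union> A\<close> and
  \<open>insert e S\<close>, whose intersection contains \<open>S\<close>.\<close>

lemma g_union_le:
  assumes f: "f \<in> F" and S: "S \<subseteq> U" and A: "A \<subseteq> U"
  shows "g f (S \<union> A) - g f S \<le> (\<Sum>e\<in>A. g f (insert e S) - g f S)"
proof -
  have "finite A" using A finite_U by (rule finite_subset)
  then show ?thesis using A
  proof (induction A rule: finite_induct)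
    case (insert e A)
    have "g f ((S \<union> A) \<union> insert e S) + g f ((S \<union> A) \<inter> insert e S) \<le> g f (S \<union> A) + g f (insert e S)"
      using submodular[OF f] S insert.prems unfolding submodular_on_def
      by (elim allE[of _ "S \<union> A"] allE[of _ "insert e S"] impE) auto
    moreover have "g f S \<le> g f ((S \<union> A) \<inter> insert e S)"
      using S insert.prems by (intro g_mono[OF f]) auto
    moreover have "(S \<union> A) \<union> insert e S = S \<union> insert e A" by auto
    ultimately show ?case using insert by simp
  qed simp
qed

text \<open>If \<open>T\<close> covers a function that \<open>S\<close> does not, the marginals of
  the elements of \<open>T\<close> over \<open>S\<close> fill the whole deficit
  \<open>1 - g f S\<close>, so the normalized marginals sum to at least 1. Every other function has
  a nonpositive left side and a nonnegative right side.\<close>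

lemma remaining_diff_le_sum_gain:
  assumes S: "S \<subseteq> U" and T: "T \<subseteq> U"
  shows "remaining S - remaining T \<le> (\<Sum>e\<in>T. gain S e)"
proof -
  have "remaining S - remaining T \<le>
      (\<Sum>f\<in>F. \<Sum>e\<in>T. w f * ((g f (insert e S) - g f S) / (1 - g f S)))"
    unfolding remaining_eq sum_subtractf[symmetric]
  proof (rule sum_mono)
    fix f assume f: "f \<in> F"
    define d where "d = (\<Sum>e\<in>T. (g f (insert e S) - g f S) / (1 - g f S))"
    have d0: "0 \<le> d" unfolding d_def
      using S T g_le_1[OF f S] by (auto intro!: sum_nonneg divide_nonneg_nonneg g_mono f)
    have "of_bool (g f S < 1) - of_bool (g f T < 1) \<le> d"
    proof (cases "g f S < 1 \<and> g f T = 1")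
      case True
      have "1 \<le> g f (S \<union> T)"
        using g_mono[OF f, of T "S \<union> T"] S T True by auto
      then have "1 - g f S \<le> (\<Sum>e\<in>T. g f (insert e S) - g f S)"
        using g_union_le[OF f S T] by simp
      then have "1 \<le> d"
        using True by (simp add: d_def sum_divide_distrib[symmetric])
      then show ?thesis using True by simp
    next
      case False
      then show ?thesis using d0 g_le_1[OF f T] by auto
    qed
    then have "w f * (of_bool (g f S < 1) - of_bool (g f T < 1)) \<le> w f * d"
      using weight_pos[OF f] by (intro mult_left_mono) auto
    then show "w f * of_bool (g f S < 1) - w f * of_bool (g f T < 1)
        \<le> (\<Sum>e\<in>T. w f * ((g f (insert e S) - g f S) / (1 - g f S)))"
      by (simp add: d_def sum_distrib_left right_diff_distrib)
  qed
  also have "\<dots> = (\<Sum>e\<in>T. gain S e)"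
    by (subst sum.swap) (simp add: gain_eq[OF S])
  finally show ?thesis .
qed

text \<open>After exchanging the sums, each function contributes the relative decreases of its own
  deficit; a function already covered at time \<open>t\<close> contributes 0.\<close>

lemma sum_gain_le:
  assumes xs: "set xs \<subseteq> U" and n: "n \<le> length xs"
  shows "(\<Sum>s=t..<n. gain (set (take s xs)) (xs ! s))
    \<le> (1 + ln (1 / \<epsilon>)) * remaining (set (take t xs))"
proof -
  have sub: "set (take s xs) \<subseteq> U" for s
    using xs set_take_subset by fast
  define a where "a f s = 1 - g f (set (take s xs))" for f s
  have "(\<Sum>s=t..<n. gain (set (take s xs)) (xs ! s))
      = (\<Sum>s=t..<n. \<Sum>f\<in>F. w f * ((a f s - a f (Suc s)) / a f s))"
    using n by (intro sum.cong refl) (simp add: gain_eq[OF sub] a_def take_Suc_conv_app_nth)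
  also have "\<dots> = (\<Sum>f\<in>F. w f * (\<Sum>s=t..<n. (a f s - a f (Suc s)) / a f s))"
    by (subst sum.swap) (simp add: sum_distrib_left)
  also have "\<dots> \<le> (\<Sum>f\<in>F. w f * ((1 + ln (1 / \<epsilon>)) * of_bool (g f (set (take t xs)) < 1)))"
  proof (intro sum_mono mult_left_mono)
    fix f assume f: "f \<in> F"
    have "(\<Sum>s=t..<n. (a f s - a f (Suc s)) / a f s) \<le> (if a f t = 0 then 0 else 1 + ln (1 / \<epsilon>))"
    proof (rule sum_relative_decrease_le[OF eps(1)])
      fix s
      show "a f (Suc s) \<le> a f s"
        unfolding a_def using g_mono[OF f set_take_subset_set_take sub, of s "Suc s"] by simp
      show "0 \<le> a f s" "a f s \<le> 1"
        unfolding a_def using g_le_1[OF f sub] nonneg[OF f sub] by auto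
      show "\<epsilon> \<le> a f s" if "0 < a f s"
        using that gap[OF f sub] by (simp add: a_def)
    qed
    also have "\<dots> = (1 + ln (1 / \<epsilon>)) * of_bool (g f (set (take t xs)) < 1)"
      using g_le_1[OF f sub, of t] by (auto simp: a_def)
    finally show "(\<Sum>s=t..<n. (a f s - a f (Suc s)) / a f s)
      \<le> (1 + ln (1 / \<epsilon>)) * of_bool (g f (set (take t xs)) < 1)" .
    show "0 \<le> w f" using weight_pos[OF f] by simp
  qed
  also have "\<dots> = (1 + ln (1 / \<epsilon>)) * remaining (set (take t xs))"
    unfolding remaining_eq by (simp add: sum_distrib_left mult_ac)
  finally show ?thesis .
qed

section \<open>Comparison of greedy with an arbitrary order\<close>

text \<open>Elements chosen earlier have gain 0, so the greedy choice is best among all of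
  \<open>U\<close>. This matters because prefixes of the other order may overlap the greedy
  prefix.\<close>

lemma greedy_gain_max:
  assumes gr: "greedy xs" and xs: "set xs = U" and s: "s < length xs" and e: "e \<in> U"
    and ne: "uncov (set (take s xs)) \<noteq> {}"
  shows "gain (set (take s xs)) e \<le> gain (set (take s xs)) (xs ! s)"
proof (cases "e \<in> set (take s xs)")
  case True
  then have "gain (set (take s xs)) e = 0"
    by (simp add: gain_def insert_absorb)
  then show ?thesis
    using gain_nonneg[of "set (take s xs)" "xs ! s"] s xs set_take_subset[of s xs] by auto
next
  case False
  then show ?thesis using gr s e ne unfolding greedy_def by auto
qed

text \<open>The first \<tau> elements of \<open>ys\<close> have gain at most that of the greedy
  choice each, so by the assumption they cover at most half of the weight that greedy has
  left.\<close>

lemma greedy_remaining_le: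
  assumes gr: "greedy xs" and xs: "set xs = U" and ys: "set ys = U"
    and s: "s < length xs"
    and le: "2 * real \<tau> * gain (set (take s xs)) (xs ! s) \<le> remaining (set (take s xs))"
  shows "remaining (set (take s xs)) \<le> 2 * remaining (set (take \<tau> ys))"
proof (cases "uncov (set (take s xs)) = {}")
  case True
  then have "remaining (set (take s xs)) = 0" by (simp add: remaining_def)
  then show ?thesis using remaining_nonneg by simp
next
  case False
  let ?S = "set (take s xs)" and ?T = "set (take \<tau> ys)"
  have S: "?S \<subseteq> U" and T: "?T \<subseteq> U"
    using xs ys set_take_subset by fast+
  have card: "card ?T \<le> \<tau>"
    using card_length[of "take \<tau> ys"] by simp
  have P: "0 \<le> gain ?S (xs ! s)" using gain_nonneg[OF S] s xs by auto
  have "remaining ?S - remaining ?T \<le> (\<Sum>e\<in>?T. gain ?S e)"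
    by (rule remaining_diff_le_sum_gain[OF S T])
  also have "\<dots> \<le> real (card ?T) * gain ?S (xs ! s)"
    using T by (intro sum_bounded_above greedy_gain_max[OF gr xs s _ False]) auto
  also have "\<dots> \<le> real \<tau> * gain ?S (xs ! s)"
    using card P by (intro mult_right_mono) auto
  finally show ?thesis using le by simp
qed

text \<open>The qualifying \<tau> are those up to \<open>R / (2 * P)\<close>, when \<open>P\<close>
  is positive; counting 0 as well makes their number times \<open>2 * P\<close> reach
  \<open>R\<close>.\<close>

lemma greedy_remaining_le_card:
  assumes gr: "greedy xs" and xs: "set xs = U" and ys: "set ys = U"
    and s: "s < length xs"
  defines "P \<equiv> gain (set (take s xs)) (xs ! s)" and "R \<equiv> remaining (set (take s xs))"
  shows "R \<le> 2 * P * real (card {\<tau>. \<tau> < length ys \<and> 2 * real \<tau> * P \<le> R})"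
proof (cases "R = 0")
  case True
  have "0 \<le> P" unfolding P_def
    using gain_nonneg[of "set (take s xs)"] s xs set_take_subset[of s xs] by auto
  then show ?thesis using True by simp
next
  case False
  have P: "0 \<le> P" unfolding P_def
    using gain_nonneg[of "set (take s xs)"] s xs set_take_subset[of s xs] by auto
  have R: "0 < R" using False remaining_nonneg[of "set (take s xs)"] by (simp add: R_def)
  \<comment> \<open>Otherwise \<open>R\<close> would be at most twice \<open>remaining U\<close>,
    which is 0. Hence the cutoff at \<open>length ys\<close> loses no qualifying \<tau>, and
    \<open>P = 0\<close> is excluded.\<close>
  have fail: "\<not> 2 * real (length ys) * P \<le> R"
    using greedy_remaining_le[OF gr xs ys s, of "length ys"] R ys remaining_U
    by (auto simp: P_def R_def)
  define c where "c = (LEAST \<tau>. \<not> 2 * real \<tau> * P \<le> R)"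
  have c: "\<not> 2 * real c * P \<le> R"
    unfolding c_def using fail by (rule LeastI)
  have "c \<le> length ys"
    unfolding c_def using fail by (rule Least_le)
  then have "{..<c} \<subseteq> {\<tau>. \<tau> < length ys \<and> 2 * real \<tau> * P \<le> R}"
    using not_less_Least[of _ "\<lambda>\<tau>. \<not> 2 * real \<tau> * P \<le> R", folded c_def] by auto
  then have "c \<le> card {\<tau>. \<tau> < length ys \<and> 2 * real \<tau> * P \<le> R}"
    using card_mono[of "{\<tau>. \<tau> < length ys \<and> 2 * real \<tau> * P \<le> R}" "{..<c}"] by simp
  then have "2 * P * real c \<le> 2 * P * real (card {\<tau>. \<tau> < length ys \<and> 2 * real \<tau> * P \<le> R})"
    using P by (intro mult_left_mono) auto
  then show ?thesis using c by (simp add: mult_ac)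
qed

text \<open>The factor 4 is a product of two factors 2: one from the count of \<tau> for each
  \<open>s\<close>, one from the halving bound for each \<tau>.\<close>

lemma greedy_sum_remaining_le:
  assumes gr: "greedy xs" and xs: "set xs = U" and ys: "set ys = U"
  shows "(\<Sum>t<length xs. remaining (set (take t xs)))
    \<le> 4 * (1 + ln (1 / \<epsilon>)) * (\<Sum>t<length ys. remaining (set (take t ys)))"
proof -
  define P where "P s = gain (set (take s xs)) (xs ! s)" for s
  define R where "R s = remaining (set (take s xs))" for s
  define R' where "R' \<tau> = remaining (set (take \<tau> ys))" for \<tau>
  define \<alpha> where "\<alpha> = 1 + ln (1 / \<epsilon>)"
  have \<alpha>: "0 \<le> \<alpha>" using eps by (simp add: \<alpha>_def)
  have P: "0 \<le> P s" if "s < length xs" for s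
    unfolding P_def using gain_nonneg[of "set (take s xs)"] that xs set_take_subset[of s xs] by auto
  have tail: "(\<Sum>s | s < length xs \<and> 2 * real \<tau> * P s \<le> R s. P s) \<le> 2 * \<alpha> * R' \<tau>" for \<tau>
  proof (cases "{s. s < length xs \<and> 2 * real \<tau> * P s \<le> R s} = {}")
    case True
    show ?thesis
      unfolding True R'_def sum.empty by (intro mult_nonneg_nonneg \<alpha> remaining_nonneg zero_le_numeral)
  next
    case False
    \<comment> \<open>The qualifying times need not form an interval; all of them lie in the tail
      from the first one, and the extra terms there are nonnegative.\<close>
    define t where "t = (LEAST s. s < length xs \<and> 2 * real \<tau> * P s \<le> R s)"
    have t: "t < length xs \<and> 2 * real \<tau> * P t \<le> R t"
      unfolding t_def by (rule LeastI_ex) (use False in blast)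
    have "(\<Sum>s | s < length xs \<and> 2 * real \<tau> * P s \<le> R s. P s) \<le> (\<Sum>s=t..<length xs. P s)"
      by (intro sum_mono2) (auto simp: P t_def intro: Least_le)
    also have "\<dots> \<le> \<alpha> * R t"
      unfolding P_def R_def \<alpha>_def using xs by (intro sum_gain_le) auto
    also have "\<dots> \<le> \<alpha> * (2 * R' \<tau>)"
      using t \<alpha> greedy_remaining_le[OF gr xs ys, of t \<tau>]
      by (intro mult_left_mono) (auto simp: P_def R_def R'_def)
    finally show ?thesis by simp
  qed
  have "(\<Sum>s<length xs. R s)
      \<le> (\<Sum>s<length xs. 2 * P s * real (card {\<tau>. \<tau> < length ys \<and> 2 * real \<tau> * P s \<le> R s}))"
    using greedy_remaining_le_card[OF gr xs ys] by (intro sum_mono) (auto simp: P_def R_def)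
  also have "\<dots> = 2 * (\<Sum>s<length xs. \<Sum>\<tau> | \<tau> \<in> {..<length ys} \<and> 2 * real \<tau> * P s \<le> R s. P s)"
    by (simp add: sum_distrib_left mult_ac)
  \<comment> \<open>The double counting: the same pairs are now grouped by \<tau>.\<close>
  also have "\<dots> = 2 * (\<Sum>\<tau><length ys. \<Sum>s | s \<in> {..<length xs} \<and> 2 * real \<tau> * P s \<le> R s. P s)"
    by (subst sum.swap_restrict) auto
  also have "\<dots> \<le> 2 * (\<Sum>\<tau><length ys. 2 * \<alpha> * R' \<tau>)"
    using tail by (intro mult_left_mono sum_mono) auto
  also have "\<dots> = 4 * \<alpha> * (\<Sum>\<tau><length ys. R' \<tau>)"
    by (simp add: sum_distrib_left mult_ac)
  finally show ?thesis by (simp add: R_def R'_def \<alpha>_def)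
qed

section \<open>From uncovered weight to cover times\<close>

text \<open>The last sum, from functions covered at the outset, is the same for every order.\<close>

lemma sum_cov_eq:
  assumes xs: "set xs = U" and ne: "xs \<noteq> []"
  shows "(\<Sum>f\<in>F. w f * real (cov (g f) xs))
    = (\<Sum>t<length xs. remaining (set (take t xs))) + (\<Sum>f\<in>F. w f * of_bool (g f {} = 1))"
proof -
  have "real (cov (g f) xs)
      = (\<Sum>t<length xs. of_bool (g f (set (take t xs)) < 1)) + of_bool (g f {} = 1)" if "f \<in> F" for f
  proof -
    have "cov (g f) xs = card {t. t < length xs \<and> g f (set (take t xs)) < 1} + (if g f {} = 1 then 1 else 0)"
      using that xs ne full mono by (intro cov_eq_card) auto
    moreover have "{t. t < length xs \<and> g f (set (take t xs)) < 1}
        = {..<length xs} \<inter> {t. g f (set (take t xs)) < 1}" by auto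
    ultimately show ?thesis
      by (auto simp: sum_of_bool_eq)
  qed
  then have "(\<Sum>f\<in>F. w f * real (cov (g f) xs))
      = (\<Sum>f\<in>F. (\<Sum>t<length xs. w f * of_bool (g f (set (take t xs)) < 1)) + w f * of_bool (g f {} = 1))"
    by (intro sum.cong refl) (simp add: distrib_left sum_distrib_left)
  also have "\<dots> = (\<Sum>t<length xs. remaining (set (take t xs))) + (\<Sum>f\<in>F. w f * of_bool (g f {} = 1))"
    unfolding sum.distrib remaining_eq by (subst sum.swap) simp
  finally show ?thesis .
qed

theorem greedy_sum_cov_le:
  assumes gr: "greedy xs" and xs: "set xs = U" and ys: "set ys = U" and ne: "U \<noteq> {}"
  shows "(\<Sum>f\<in>F. w f * real (cov (g f) xs))
    \<le> 4 * (1 + ln (1 / \<epsilon>)) * (\<Sum>f\<in>F. w f * real (cov (g f) ys))"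
proof -
  have ne': "xs \<noteq> []" "ys \<noteq> []" using ne xs ys by auto
  have "0 \<le> ln (1 / \<epsilon>)" using eps by simp
  \<comment> \<open>The order-independent part is absorbed because the factor is at least 1.\<close>
  then have "1 * (\<Sum>f\<in>F. w f * of_bool (g f {} = 1))
      \<le> 4 * (1 + ln (1 / \<epsilon>)) * (\<Sum>f\<in>F. w f * of_bool (g f {} = 1))"
    by (intro mult_right_mono sum_nonneg) (auto intro: less_imp_le weight_pos)
  then show ?thesis
    using greedy_sum_remaining_le[OF gr xs ys]
    by (simp add: sum_cov_eq[OF xs ne'(1)] sum_cov_eq[OF ys ne'(2)] distrib_left)
qed

end

section \<open>Back to several agents\<close>

text \<open>Turns the inductive run into a condition on each position, as \<open>greedy\<close>
  demands. Appending an element leaves earlier prefixes intact, and a \<open>rest\<close> step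
  contradicts the assumption at its own position.\<close>

lemma NG_run_is_arg_max:
  assumes "NG_run I xs" and "t < length xs" and "uncovered I (set (take t xs)) \<noteq> {}"
  shows "is_arg_max (score I (set (take t xs))) (\<lambda>e. e \<in> ground I - set (take t xs)) (xs ! t)"
  using assms
proof induction
  case (greedy xs e)
  then show ?case by (cases "t = length xs") (simp_all add: nth_append)
next
  case (rest xs e)
  then show ?case by (cases "t = length xs") (simp_all add: nth_append)
qed simp

theorem theorem2:
  fixes I :: srma and \<epsilon> :: real and \<pi> :: "nat list"
  assumes "srma_instance I"
    and "marginal_bound I \<epsilon>"
    and "NG_output I \<pi>"
  shows "objective I \<pi>
    \<le> (4 * real (agents I) * ln (1 / \<epsilon>) + 8 * real (agents I)) * OPT I"
proof -
  define F where "F = {1..agents I} \<times> {1..funs I}"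
  define g where "g = (\<lambda>(i, j). fn I i j)"
  define w where "w = (\<lambda>(i, j). wt I i j)"
  have inst: "mono_on (Pow (ground I)) (g f)" "submodular_on (ground I) (g f)"
    "\<And>S. S \<subseteq> ground I \<Longrightarrow> g f S \<in> {0..1}" "g f (ground I) = 1" "0 < w f" if "f \<in> F" for f
    using assms(1) that by (auto simp: srma_instance_def F_def g_def w_def)
  have bound: "0 < \<epsilon>" "\<epsilon> \<le> 1"
    "\<And>f S. f \<in> F \<Longrightarrow> S \<subseteq> ground I \<Longrightarrow> g f S < g f (ground I) \<Longrightarrow> \<epsilon> \<le> g f (ground I) - g f S"
    using assms(2) by (auto simp: marginal_bound_def F_def g_def)
  interpret submodular_ranking "ground I" F g w \<epsilon>
    using inst bound(1,2) bound(3)[unfolded inst(4)]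
    by unfold_locales (auto simp: F_def ground_def)
  define C where "C \<sigma> i = (\<Sum>j=1..funs I. wt I i j * real (cov (fn I i j) \<sigma>))" for \<sigma> i
  have total: "(\<Sum>f\<in>F. w f * real (cov (g f) \<sigma>)) = (\<Sum>i=1..agents I. C \<sigma> i)" for \<sigma>
    unfolding C_def F_def sum.cartesian_product by (intro sum.cong) (auto simp: g_def w_def)
  have agents: "{1..agents I} \<noteq> {}" and ground: "ground I \<noteq> {}"
    using assms(1) by (auto simp: srma_instance_def ground_def)
  have obj: "objective I \<sigma> = Max (C \<sigma> ` {1..agents I})" for \<sigma>
    by (simp add: objective_def C_def[abs_def])
  have C_nonneg: "0 \<le> C \<sigma> i" if "i \<in> {1..agents I}" for \<sigma> i
    using assms(1) that unfolding C_def srma_instance_def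
    by (intro sum_nonneg mult_nonneg_nonneg) (auto intro: less_imp_le)
  have C_le: "C \<sigma> i \<le> objective I \<sigma>" if "i \<in> {1..agents I}" for \<sigma> i
    unfolding obj using that by (intro Max_ge) auto
  have \<pi>: "set \<pi> = ground I" and run: "NG_run I \<pi>"
    using assms(3) by (auto simp: NG_output_def)
  have unc: "uncov S = uncovered I S" and sc: "gain S e = score I S e" for S e
  proof -
    show *: "uncov S = uncovered I S"
      unfolding uncov_def uncovered_def by (auto simp: F_def g_def)
    show "gain S e = score I S e"
      unfolding gain_def score_def * by (intro sum.cong) (auto simp: g_def w_def)
  qed
  have gr: "greedy \<pi>"
    using NG_run_is_arg_max[OF run] unfolding greedy_def unc sc
    by (auto simp: is_arg_max_linorder)
  have "OPT I \<in> objective I ` permutations_of_set (ground I)"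
    unfolding OPT_def using finite_U by (intro Min_in) auto
  then obtain \<sigma> where \<sigma>: "set \<sigma> = ground I" and opt: "OPT I = objective I \<sigma>"
    by (auto simp: permutations_of_set_def)
  have ln: "0 \<le> ln (1 / \<epsilon>)" using eps by simp
  have opt_nonneg: "0 \<le> OPT I"
    using agents C_nonneg[of 1 \<sigma>] C_le[of 1 \<sigma>] opt by auto
  \<comment> \<open>The maximum is at most the sum, as the costs of the agents are
    nonnegative.\<close>
  have "objective I \<pi> \<le> (\<Sum>i=1..agents I. C \<pi> i)"
    unfolding obj using agents by (subst Max_le_iff) (auto intro!: member_le_sum C_nonneg)
  also have "\<dots> \<le> 4 * (1 + ln (1 / \<epsilon>)) * (\<Sum>i=1..agents I. C \<sigma> i)"
    using greedy_sum_cov_le[OF gr \<pi> \<sigma> ground] unfolding total .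
  also have "\<dots> \<le> 4 * (1 + ln (1 / \<epsilon>)) * (real (agents I) * OPT I)"
    using sum_bounded_above[of "{1..agents I}" "C \<sigma>" "OPT I"] C_le opt ln
    by (intro mult_left_mono) auto
  \<comment> \<open>The argument yields the additive term 4k; it is relaxed here to the stated
    8k.\<close>
  also have "\<dots> \<le> 4 * (2 + ln (1 / \<epsilon>)) * (real (agents I) * OPT I)"
    using opt_nonneg by (intro mult_right_mono) auto
  also have "\<dots> = (4 * real (agents I) * ln (1 / \<epsilon>) + 8 * real (agents I)) * OPT I"
    by (simp add: algebra_simps)
  finally show ?thesis .
qed

end
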